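(* Let $G$ be a connected graph of order $n\ge2$ with distances $d_{rt}=d_G(v_r,v_t)$, and let $\mathcal{D}^S_r=\sum_{t=1,\,t\neq r}^n(2d_{rt}-1)$ for $1\le r\le n$. Then $$\rho^S(G)\ge\sqrt{\frac{\sum_{r=1}^n(\mathcal{D}^S_r)^2}{n}},$$ with equality if and only if $\mathcal{D}^S_1=\mathcal{D}^S_2=\cdots=\mathcal{D}^S_n$.
   Context: The distance Seidel matrix of a connected graph $G$ on $v_1,\dots,v_n$ is $\mathcal{D}^S(G)=J-I-2\mathcal{D}(G)$, where $\mathcal{D}(G)=(d_{rt})$ is the distance matrix and $J$ the all-ones matrix. The distance Seidel spectral radius $\rho^S(G)$ is $\max_i|\partial_i^S|$ over the eigenvalues of $\mathcal{D}^S(G)$; equivalently the largest eigenvalue of $-\mathcal{D}^S(G)$. *)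

theory Defs
  imports
    "Graph_Theory.Graph_Theory"
    "Jordan_Normal_Form.Spectral_Radius"
begin

text \<open>
  Undirected simple graphs are the members of the locale \<^locale>\<open>graph\<close> (finite, symmetric,
  without loops or multiple arcs). The matrices are indexed by positions in a list \<open>vs\<close>
  that enumerates the vertices; theorems assume \<open>distinct vs\<close> and \<open>set vs = verts G\<close>.
\<close>

text \<open>
  The shortest-path cost \<open>\<mu>\<close> is an infimum in \<^typ>\<open>ereal\<close>. With unit arc costs it
  is the length of a shortest walk; for disconnected vertices it is infinite, which
  \<^const>\<open>real_of_ereal\<close> sends to \<open>0\<close>. See \<open>graph_dist_shortest_walk\<close> below.
\<close>

definition graph_dist :: "('a, 'b) pre_digraph \<Rightarrow> 'a \<Rightarrow> 'a \<Rightarrow> real" where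
  "graph_dist G u v = real_of_ereal (wf_digraph.\<mu> G (\<lambda>_. 1) u v)"

definition distance_matrix :: "('a, 'b) pre_digraph \<Rightarrow> 'a list \<Rightarrow> real mat" where
  "distance_matrix G vs =
     mat (length vs) (length vs) (\<lambda>(r, t). graph_dist G (vs ! r) (vs ! t))"

definition distance_seidel_matrix :: "('a, 'b) pre_digraph \<Rightarrow> 'a list \<Rightarrow> real mat" where
  "distance_seidel_matrix G vs =
     mat (length vs) (length vs) (\<lambda>_. 1) - 1\<^sub>m (length vs) - 2 \<cdot>\<^sub>m distance_matrix G vs"

text \<open>
  The library's spectral radius is the maximal modulus of the complex eigenvalues; the matrix
  is real symmetric, so these are exactly its real eigenvalues.
\<close>

definition distance_seidel_spectral_radius :: "('a, 'b) pre_digraph \<Rightarrow> 'a list \<Rightarrow> real" where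
  "distance_seidel_spectral_radius G vs =
     spectral_radius (map_mat complex_of_real (distance_seidel_matrix G vs))"

definition distance_seidel_degree :: "('a, 'b) pre_digraph \<Rightarrow> 'a list \<Rightarrow> nat \<Rightarrow> real" where
  "distance_seidel_degree G vs r =
     (\<Sum>t \<in> {..<length vs} - {r}. (2 * graph_dist G (vs ! r) (vs ! t) - 1))"

lemma (in wf_digraph) graph_dist_shortest_walk:
  assumes "u \<rightarrow>\<^sup>* v"
  shows "\<exists>p. awalk u p v \<and> graph_dist G u v = length p \<and> (\<forall>q. awalk u q v \<longrightarrow> length p \<le> length q)"
proof -
  have cost: "awalk_cost (\<lambda>_. 1) q = length q" for q :: "'b list"
    by (induction q) auto
  obtain q0 where "awalk u q0 v"
    using assms by (auto simp: reachable_awalk)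
  then obtain p where p: "awalk u p v" and min: "\<And>q. awalk u q v \<Longrightarrow> length p \<le> length q"
    using ex_has_least_nat[of "\<lambda>q. awalk u q v" q0 length] by auto
  have "\<mu> (\<lambda>_. 1) u v = ereal (length p)"
    unfolding \<mu>_def using p min by (intro antisym INF_greatest INF_lower2[of p]) (auto simp: cost)
  then show ?thesis
    using p min by (auto simp: graph_dist_def)
qed

end

theory Submission
  imports Defs
begin

text \<open>
  Let \<open>A\<close> be the distance Seidel matrix, \<open>\<rho>\<close> its spectral radius and \<open>y = -A 1\<close> the vector of
  degrees. As \<open>A\<close> is real symmetric, \<open>\<parallel>A x\<parallel> \<le> \<rho> \<parallel>x\<parallel>\<close> for all \<open>x\<close>, and \<open>x = 1\<close> gives the inequality.
  The norm bound is obtained without diagonalising: by Cauchy--Schwarz the numbers \<open>\<parallel>A^k x\<parallel>\<^sup>2\<close> are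
  log-convex in \<open>k\<close>, so they grow at least like \<open>(\<parallel>A x\<parallel> / \<parallel>x\<parallel>)^(2k)\<close>, whereas the entries
  of \<open>A^k\<close> are \<open>O(c^k)\<close> for every \<open>c > \<rho>\<close>.

  If equality holds then \<open>A\<^sup>2 1 = \<rho>\<^sup>2 1\<close>, that is, \<open>\<Sum>t. a\<^sub>r\<^sub>t y\<^sub>t = \<rho>\<^sup>2\<close> for all \<open>r\<close>, where \<open>a = -A\<close> is
  positive off the diagonal. Reading this off at a maximal entry \<open>y\<^sub>i\<close> and at a minimal
  entry \<open>y\<^sub>j\<close> gives \<open>y\<^sub>i y\<^sub>j \<le> \<rho>\<^sup>2 \<le> y\<^sub>j y\<^sub>i\<close>, and equality in both estimates forces \<open>y\<close> to be
  constant. Conversely, if \<open>y\<close> is constant then \<open>\<rho>\<close> is at most the common absolute row sum.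
\<close>

section \<open>Spectral radius of real symmetric matrices\<close>

lemma pow_smult_mat:
  fixes A :: "'a :: comm_semiring_1 mat"
  assumes "A \<in> carrier_mat n n"
  shows "(c \<cdot>\<^sub>m A) ^\<^sub>m k = c ^ k \<cdot>\<^sub>m (A ^\<^sub>m k)"
proof (induction k)
  case 0
  show ?case by (intro eq_matI) auto
next
  case (Suc k)
  have "(c \<cdot>\<^sub>m A) ^\<^sub>m Suc k = (c ^ k \<cdot>\<^sub>m (A ^\<^sub>m k)) * (c \<cdot>\<^sub>m A)"
    using Suc by simp
  also have "\<dots> = c ^ k \<cdot>\<^sub>m (c \<cdot>\<^sub>m (A ^\<^sub>m k * A))"
    by (simp add: mult_smult_assoc_mat[OF pow_carrier_mat[OF assms] smult_carrier_mat[OF assms]]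
        mult_smult_distrib[OF pow_carrier_mat[OF assms] assms])
  also have "\<dots> = c ^ Suc k \<cdot>\<^sub>m (A ^\<^sub>m Suc k)"
    by (intro eq_matI) (auto simp: mult_ac)
  finally show ?case .
qed

lemma spectral_radius_nonneg:
  assumes "A \<in> carrier_mat n n" "n > 0"
  shows "0 \<le> spectral_radius A"
  using spectral_radius_mem_max(1)[OF assms] by auto

lemma eigenvalue_smult:
  fixes A :: "'a :: field mat"
  assumes A: "A \<in> carrier_mat n n" and "c \<noteq> 0" and "eigenvalue (c \<cdot>\<^sub>m A) a"
  shows "eigenvalue A (a / c)"
proof -
  obtain v where v: "v \<in> carrier_vec n" "v \<noteq> 0\<^sub>v n" and eq: "(c \<cdot>\<^sub>m A) *\<^sub>v v = a \<cdot>\<^sub>v v"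
    using assms by (auto simp: eigenvalue_def eigenvector_def)
  have "A *\<^sub>v v = (a / c) \<cdot>\<^sub>v v"
  proof (intro eq_vecI)
    fix i assume "i < dim_vec ((a / c) \<cdot>\<^sub>v v)"
    then have i: "i < n" using v by simp
    have "((c \<cdot>\<^sub>m A) *\<^sub>v v) $ i = (a \<cdot>\<^sub>v v) $ i" by (simp add: eq)
    then have "c * (A *\<^sub>v v) $ i = a * v $ i"
      using i A v by (simp add: row_smult)
    then show "(A *\<^sub>v v) $ i = ((a / c) \<cdot>\<^sub>v v) $ i"
      using i v \<open>c \<noteq> 0\<close> by (simp add: field_simps)
  qed (use A v in auto)
  then show ?thesis using v A by (auto simp: eigenvalue_def eigenvector_def)
qed

text \<open>Dividing \<open>A\<close> by \<open>c\<close> brings the spectral radius below 1, and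
  the powers of such a matrix are uniformly bounded; scaling back contributes the factor
  \<open>c ^ k\<close>.\<close>

lemma pow_mat_entries_bound:
  fixes A :: "complex mat"
  assumes A: "A \<in> carrier_mat n n" and n: "n > 0" and c: "spectral_radius A < c"
  shows "\<exists>C. \<forall>k. \<forall>i<n. \<forall>j<n. norm ((A ^\<^sub>m k) $$ (i, j)) \<le> C * c ^ k"
proof -
  have c0: "c > 0" using spectral_radius_nonneg[OF A n] c by simp
  let ?B = "complex_of_real (1 / c) \<cdot>\<^sub>m A"
  have B: "?B \<in> carrier_mat n n" using A by simp
  obtain b where b: "eigenvalue ?B b" "spectral_radius ?B = norm b"
    using spectral_radius_mem_max(1)[OF B n] by (auto simp: spectrum_def)
  have "eigenvalue A (b / complex_of_real (1 / c))"
    using b(1) c0 by (intro eigenvalue_smult[OF A]) auto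
  then have "norm (b / complex_of_real (1 / c)) \<le> spectral_radius A"
    by (intro spectral_radius_mem_max(2)[OF A n]) (auto simp: spectrum_def)
  then have "norm b * c \<le> spectral_radius A" using c0 by (simp add: norm_divide norm_mult)
  then have "norm b * c < 1 * c" using c by linarith
  then have "norm b < 1" using c0 by (simp only: mult_less_cancel_right_pos)
  then have "spectral_radius ?B < 1" using b by simp
  then obtain C where C: "\<And>k. norm_bound (?B ^\<^sub>m k) C"
    using spectral_radius_jnf_norm_bound_less_1_upper_triangular[OF B] by blast
  have "norm ((A ^\<^sub>m k) $$ (i, j)) \<le> C * c ^ k" if "i < n" "j < n" for k i j
  proof -
    have "norm ((?B ^\<^sub>m k) $$ (i, j)) \<le> C"
      using C[of k] that A by (auto simp: norm_bound_def)
    moreover have "(?B ^\<^sub>m k) $$ (i, j) = complex_of_real (1 / c) ^ k * (A ^\<^sub>m k) $$ (i, j)"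
      using that A by (simp add: pow_smult_mat[OF A])
    ultimately have "norm ((A ^\<^sub>m k) $$ (i, j)) / c ^ k \<le> C"
      using c0 by (simp add: norm_mult norm_divide norm_power power_divide)
    then show ?thesis using c0 by (simp add: field_simps)
  qed
  then show ?thesis by blast
qed

text \<open>Log-convexity makes the successive ratios nondecreasing, so each is at least the first
  one, \<open>a 1 / a 0\<close>.\<close>

lemma log_convex_growth:
  fixes a :: "nat \<Rightarrow> real"
  assumes nonneg: "\<And>k. 0 \<le> a k" and convex: "\<And>k. (a (Suc k))\<^sup>2 \<le> a k * a (Suc (Suc k))"
    and a0: "a 0 > 0" and a1: "a 1 > 0"
  shows "a 0 * (a 1 / a 0) ^ k \<le> a k"
proof -
  \<comment> \<open>Positivity is carried along in the induction because cancelling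
    \<open>a k\<close> needs it; the ratio bound in turn passes it on to
    \<open>a (Suc k)\<close>.\<close>
  have step: "a k > 0 \<and> a 1 / a 0 * a k \<le> a (Suc k)" for k
  proof (induction k)
    case 0
    then show ?case using a0 by simp
  next
    case (Suc k)
    then have "0 < a 1 / a 0 * a k" using a0 a1 by simp
    then have pos: "a k > 0" "a (Suc k) > 0"
      using Suc by (auto simp del: times_divide_eq_left)
    have "a 1 / a 0 * a k * a (Suc k) \<le> a (Suc k) * a (Suc k)"
      using Suc pos by (intro mult_right_mono) auto
    also have "\<dots> \<le> a k * a (Suc (Suc k))"
      using convex[of k] by (simp add: power2_eq_square)
    finally have "a k * (a 1 / a 0 * a (Suc k)) \<le> a k * a (Suc (Suc k))"
      by (simp add: mult_ac)
    then show ?case using pos by (simp only: mult_le_cancel_left_pos)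
  qed
  show ?thesis
  proof (induction k)
    case (Suc k)
    have "a 0 * (a 1 / a 0) ^ Suc k = a 1 / a 0 * (a 0 * (a 1 / a 0) ^ k)" by simp
    also have "\<dots> \<le> a 1 / a 0 * a k"
      using Suc a0 a1 by (intro mult_left_mono) auto
    also have "\<dots> \<le> a (Suc k)" using step by simp
    finally show ?case .
  qed simp
qed

section \<open>Norm bounds for real symmetric matrices\<close>

lemma scalar_prod_self_nonneg: "0 \<le> (x :: real vec) \<bullet> x"
  by (auto simp: scalar_prod_def intro: sum_nonneg)

lemma scalar_prod_Cauchy_Schwarz:
  fixes x y :: "real vec"
  assumes "x \<in> carrier_vec n" "y \<in> carrier_vec n"
  shows "(x \<bullet> y)\<^sup>2 \<le> (x \<bullet> x) * (y \<bullet> y)"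
proof (cases "y \<bullet> y = 0")
  case True
  then have "y $ i = 0" if "i < n" for i
    using that assms by (auto simp: scalar_prod_def sum_nonneg_eq_0_iff)
  then have "x \<bullet> y = 0" using assms by (simp add: scalar_prod_def)
  then show ?thesis using True by simp
next
  case False
  \<comment> \<open>The squared norm of \<open>s x - q y\<close> expands to
    \<open>s * (p * s - q\<^sup>2)\<close>, and \<open>s\<close> is positive in this case.\<close>
  define p q s where "p = x \<bullet> x" and "q = x \<bullet> y" and "s = y \<bullet> y"
  have "(\<Sum>i<n. (s * x $ i - q * y $ i)\<^sup>2) =
      (\<Sum>i<n. s * s * (x $ i * x $ i) - 2 * s * q * (x $ i * y $ i) + q * q * (y $ i * y $ i))"
    by (intro sum.cong) (auto simp: power2_eq_square algebra_simps)
  also have "\<dots> = s * s * (\<Sum>i<n. x $ i * x $ i) - 2 * s * q * (\<Sum>i<n. x $ i * y $ i) +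
      q * q * (\<Sum>i<n. y $ i * y $ i)"
    by (simp only: sum.distrib sum_subtractf sum_distrib_left)
  also have "\<dots> = s * s * p - 2 * s * q * q + q * q * s"
    using assms by (simp add: p_def q_def s_def scalar_prod_def atLeast0LessThan)
  also have "\<dots> = s * (p * s - q\<^sup>2)" by (simp add: power2_eq_square algebra_simps)
  finally have "(\<Sum>i<n. (s * x $ i - q * y $ i)\<^sup>2) = s * (p * s - q\<^sup>2)" .
  moreover have "0 \<le> (\<Sum>i<n. (s * x $ i - q * y $ i)\<^sup>2)" by (intro sum_nonneg) simp
  ultimately have "0 \<le> s * (p * s - q\<^sup>2)" by simp
  moreover have "0 < s" using False scalar_prod_self_nonneg[of y] by (simp add: s_def)
  ultimately have "0 \<le> p * s - q\<^sup>2" by (simp add: zero_le_mult_iff)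
  then show ?thesis by (simp add: p_def q_def s_def)
qed

lemma symmetric_mat_scalar_prod:
  fixes A :: "real mat"
  assumes "A \<in> carrier_mat n n" "A\<^sup>T = A" "x \<in> carrier_vec n" "y \<in> carrier_vec n"
  shows "(A *\<^sub>v x) \<bullet> y = x \<bullet> (A *\<^sub>v y)"
  using transpose_vec_mult_scalar[OF assms(1,4,3)] assms
    comm_scalar_prod[of "A *\<^sub>v x" n y] comm_scalar_prod[of x n "A *\<^sub>v y"]
  by (metis mult_mat_vec_carrier transpose_vec_mult_scalar)

text \<open>Iteration gives the recursion needed for log-convexity; the matrix power gives access to
  the entry bounds.\<close>

lemma funpow_mult_mat_vec:
  fixes A :: "'a :: semiring_1 mat"
  assumes A: "A \<in> carrier_mat n n" and "x \<in> carrier_vec n"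
  shows "((*\<^sub>v) A ^^ k) x = (A ^\<^sub>m k) *\<^sub>v x"
  using assms(2)
proof (induction k arbitrary: x)
  case 0
  then show ?case using A by simp
next
  case (Suc k)
  have "((*\<^sub>v) A ^^ Suc k) x = ((*\<^sub>v) A ^^ k) (A *\<^sub>v x)"
    by (simp add: funpow_swap1)
  also have "\<dots> = (A ^\<^sub>m k) *\<^sub>v (A *\<^sub>v x)"
    using Suc A by simp
  also have "\<dots> = (A ^\<^sub>m Suc k) *\<^sub>v x"
    using assoc_mult_mat_vec[OF pow_carrier_mat[OF A, of k] A Suc.prems] by simp
  finally show ?case .
qed

text \<open>Every coordinate of the product is at most \<open>b\<close> times the l1-norm of
  \<open>x\<close>. A crude constant suffices, since only the growth in the exponent matters when
  this is applied to powers.\<close>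

lemma mult_mat_vec_bound:
  fixes A :: "real mat"
  assumes A: "A \<in> carrier_mat n n" and x: "x \<in> carrier_vec n"
    and b: "\<And>i j. i < n \<Longrightarrow> j < n \<Longrightarrow> \<bar>A $$ (i, j)\<bar> \<le> b"
  shows "(A *\<^sub>v x) \<bullet> (A *\<^sub>v x) \<le> real n * (\<Sum>j<n. \<bar>x $ j\<bar>)\<^sup>2 * b\<^sup>2"
proof -
  have "((A *\<^sub>v x) $ i)\<^sup>2 \<le> (\<Sum>j<n. \<bar>x $ j\<bar>)\<^sup>2 * b\<^sup>2" if i: "i < n" for i
  proof -
    have "\<bar>(A *\<^sub>v x) $ i\<bar> = \<bar>\<Sum>j<n. A $$ (i, j) * x $ j\<bar>"
      using A x i by (simp add: scalar_prod_def atLeast0LessThan)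
    also have "\<dots> \<le> (\<Sum>j<n. \<bar>A $$ (i, j) * x $ j\<bar>)" by (rule sum_abs)
    also have "\<dots> \<le> (\<Sum>j<n. b * \<bar>x $ j\<bar>)"
      using b i by (intro sum_mono) (auto simp: abs_mult intro: mult_right_mono)
    also have "\<dots> = (\<Sum>j<n. \<bar>x $ j\<bar>) * b" by (simp add: sum_distrib_left mult.commute)
    finally have "\<bar>(A *\<^sub>v x) $ i\<bar>\<^sup>2 \<le> ((\<Sum>j<n. \<bar>x $ j\<bar>) * b)\<^sup>2"
      by (intro power_mono) auto
    then show ?thesis by (simp add: power_mult_distrib)
  qed
  then have "(\<Sum>i<n. ((A *\<^sub>v x) $ i)\<^sup>2) \<le> (\<Sum>i<n. (\<Sum>j<n. \<bar>x $ j\<bar>)\<^sup>2 * b\<^sup>2)"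
    by (intro sum_mono) auto
  moreover have "(A *\<^sub>v x) \<bullet> (A *\<^sub>v x) = (\<Sum>i<n. ((A *\<^sub>v x) $ i)\<^sup>2)"
    using A by (simp add: scalar_prod_def atLeast0LessThan power2_eq_square)
  ultimately show ?thesis by (simp add: mult_ac)
qed

lemma symmetric_mat_norm_le:
  fixes A :: "real mat"
  assumes A: "A \<in> carrier_mat n n" and sym: "A\<^sup>T = A" and x: "x \<in> carrier_vec n" and n: "n > 0"
  shows "(A *\<^sub>v x) \<bullet> (A *\<^sub>v x) \<le> (spectral_radius (map_mat complex_of_real A))\<^sup>2 * (x \<bullet> x)"
proof (cases "(A *\<^sub>v x) \<bullet> (A *\<^sub>v x) = 0")
  case True
  then show ?thesis using scalar_prod_self_nonneg[of x] by simp
next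
  case False
  let ?A = "map_mat complex_of_real A"
  let ?\<rho> = "spectral_radius ?A"
  have A': "?A \<in> carrier_mat n n" using A by simp
  have \<rho>0: "0 \<le> ?\<rho>" using spectral_radius_nonneg[OF A' n] .
  define v where "v k = ((*\<^sub>v) A ^^ k) x" for k
  define a where "a k = v k \<bullet> v k" for k
  have v: "v k \<in> carrier_vec n" for k
    by (induction k) (use A x in \<open>auto simp: v_def\<close>)
  have vSuc: "v (Suc k) = A *\<^sub>v v k" for k by (simp add: v_def)
  have nonneg: "0 \<le> a k" for k by (simp add: a_def scalar_prod_self_nonneg)
  have convex: "(a (Suc k))\<^sup>2 \<le> a k * a (Suc (Suc k))" for k
  proof -
    \<comment> \<open>One factor \<open>A\<close> moves across the scalar product, so that
      Cauchy-Schwarz applies to \<open>v k\<close> and \<open>v (Suc (Suc k))\<close>.\<close>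
    have "a (Suc k) = v k \<bullet> v (Suc (Suc k))"
      using symmetric_mat_scalar_prod[OF A sym v v, of k "Suc k"] by (simp add: a_def vSuc)
    then show ?thesis
      using scalar_prod_Cauchy_Schwarz[OF v v, of k "Suc (Suc k)"] by (simp add: a_def)
  qed
  have a1: "a 1 > 0" and a01: "a 0 = x \<bullet> x" "a 1 = (A *\<^sub>v x) \<bullet> (A *\<^sub>v x)"
    using False nonneg[of 1] by (auto simp: a_def v_def)
  \<comment> \<open>If \<open>a 0\<close> vanished, log-convexity at 0 would force
    \<open>a 1 = 0\<close>.\<close>
  have a0: "a 0 > 0"
    using convex[of 0] a1 nonneg[of 0] by (cases "a 0 = 0") auto
  have le: "a 1 / a 0 \<le> c\<^sup>2" if c: "?\<rho> < c" for c
  proof (rule ccontr)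
    assume "\<not> a 1 / a 0 \<le> c\<^sup>2"
    moreover have c0: "c > 0" using \<rho>0 c by simp
    ultimately have gt: "1 < a 1 / a 0 / c\<^sup>2" by (subst less_divide_eq_1_pos) auto
    obtain C where C: "\<And>k i j. i < n \<Longrightarrow> j < n \<Longrightarrow> norm ((?A ^\<^sub>m k) $$ (i, j)) \<le> C * c ^ k"
      using pow_mat_entries_bound[OF A' n c] by blast
    define K where "K = real n * (\<Sum>j<n. \<bar>x $ j\<bar>)\<^sup>2 * C\<^sup>2"
    have bound: "a k \<le> K * (c\<^sup>2) ^ k" for k
    proof -
      have "\<bar>(A ^\<^sub>m k) $$ (i, j)\<bar> \<le> C * c ^ k" if ij: "i < n" "j < n" for i j
      proof -
        have "?A ^\<^sub>m k = map_mat complex_of_real (A ^\<^sub>m k)"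
          using of_real_hom.mat_hom_pow[OF A] by metis
        then have "(?A ^\<^sub>m k) $$ (i, j) = complex_of_real ((A ^\<^sub>m k) $$ (i, j))"
          using ij A by simp
        then show ?thesis using C[OF ij, of k] by simp
      qed
      then have "((A ^\<^sub>m k) *\<^sub>v x) \<bullet> ((A ^\<^sub>m k) *\<^sub>v x) \<le>
          real n * (\<Sum>j<n. \<bar>x $ j\<bar>)\<^sup>2 * (C * c ^ k)\<^sup>2"
        by (intro mult_mat_vec_bound pow_carrier_mat A x)
      then show ?thesis
        by (simp add: a_def v_def funpow_mult_mat_vec[OF A x] K_def power_mult_distrib
            power_commutes flip: power_mult mult.assoc)
          (simp add: mult_ac)
    qed
    \<comment> \<open>The lower bound \<open>a 0 * (a 1 / a 0) ^ k\<close> eventually overtakes the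
      upper bound \<open>K * (c\<^sup>2) ^ k\<close>.\<close>
    obtain k where k: "K / a 0 < (a 1 / a 0 / c\<^sup>2) ^ k"
      using real_arch_pow[OF gt] by blast
    have "a 0 * (a 1 / a 0) ^ k \<le> K * (c\<^sup>2) ^ k"
      using log_convex_growth[of a k] nonneg convex a0 a1 bound[of k] by (meson order_trans)
    then have "(a 1 / a 0 / c\<^sup>2) ^ k \<le> K / a 0"
      using a0 c0 by (simp add: field_simps power_divide)
    then show False using k by simp
  qed
  have "sqrt (a 1 / a 0) \<le> ?\<rho>"
  \<comment> \<open>The entry bound is available only for \<open>c\<close> strictly above the
    spectral radius, so the estimate at the radius itself is a limit; taking the root first makes it
    linear in \<open>c\<close>.\<close>
  proof (rule dense_ge)
    fix c assume c: "?\<rho> < c"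
    show "sqrt (a 1 / a 0) \<le> c"
      using le[OF c] c \<rho>0 by (intro real_le_lsqrt) simp_all
  qed
  then have "a 1 / a 0 \<le> ?\<rho>\<^sup>2" by (rule sqrt_le_D)
  then show ?thesis using a0 a01 by (simp add: field_simps)
qed

text \<open>With \<open>z = A (A x)\<close> and \<open>s = \<rho>\<^sup>2\<close>, the norm bound
  applied to \<open>A x\<close> gives \<open>z \<bullet> z \<le> s\<^sup>2 (x \<bullet> x)\<close>,
  and symmetry gives \<open>z \<bullet> x = s (x \<bullet> x)\<close>. Hence the squared norm of
  \<open>z - s x\<close> is at most 0.\<close>

lemma symmetric_mat_norm_eq:
  fixes A :: "real mat"
  assumes A: "A \<in> carrier_mat n n" and sym: "A\<^sup>T = A" and x: "x \<in> carrier_vec n" and n: "n > 0"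
    and eq: "(A *\<^sub>v x) \<bullet> (A *\<^sub>v x) = (spectral_radius (map_mat complex_of_real A))\<^sup>2 * (x \<bullet> x)"
  shows "A *\<^sub>v (A *\<^sub>v x) = (spectral_radius (map_mat complex_of_real A))\<^sup>2 \<cdot>\<^sub>v x"
proof -
  define s where "s = (spectral_radius (map_mat complex_of_real A))\<^sup>2"
  define z where "z = A *\<^sub>v (A *\<^sub>v x)"
  have Ax: "A *\<^sub>v x \<in> carrier_vec n" using A x by (rule mult_mat_vec_carrier)
  have z: "z \<in> carrier_vec n" unfolding z_def using A Ax by (rule mult_mat_vec_carrier)
  have zz: "z \<bullet> z \<le> s * (s * (x \<bullet> x))"
    using symmetric_mat_norm_le[OF A sym Ax n] by (simp add: z_def eq s_def)
  have zx: "z \<bullet> x = s * (x \<bullet> x)"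
    using symmetric_mat_scalar_prod[OF A sym Ax x] eq by (simp add: z_def s_def)
  have "(\<Sum>i<n. (z $ i - s * x $ i)\<^sup>2) = z \<bullet> z - 2 * s * (z \<bullet> x) + s * (s * (x \<bullet> x))"
    using x z by (simp add: scalar_prod_def atLeast0LessThan power2_eq_square algebra_simps
        sum.distrib sum_subtractf sum_distrib_left)
  also have "\<dots> \<le> 0" using zz zx by simp
  finally have "(\<Sum>i<n. (z $ i - s * x $ i)\<^sup>2) = 0"
    by (intro antisym sum_nonneg) auto
  then have "z $ i = s * x $ i" if "i < n" for i
    using that by (auto simp: sum_nonneg_eq_0_iff)
  then show ?thesis
    using z x A by (intro eq_vecI) (auto simp: z_def s_def simp del: index_mult_mat_vec)
qed

text \<open>The eigenvalue equation is read at a coordinate where the eigenvector has maximal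
  modulus \<open>m\<close>; all other coordinates are estimated by \<open>m\<close>.\<close>

lemma spectral_radius_le_row_sum:
  fixes A :: "complex mat"
  assumes A: "A \<in> carrier_mat n n" and n: "n > 0"
    and row: "\<And>i. i < n \<Longrightarrow> (\<Sum>j<n. norm (A $$ (i, j))) \<le> b"
  shows "spectral_radius A \<le> b"
proof -
  obtain e where e: "eigenvalue A e" "spectral_radius A = norm e"
    using spectral_radius_mem_max(1)[OF A n] by (auto simp: spectrum_def)
  then obtain v where v: "v \<in> carrier_vec n" "v \<noteq> 0\<^sub>v n" and eq: "A *\<^sub>v v = e \<cdot>\<^sub>v v"
    using A by (auto simp: eigenvalue_def eigenvector_def)
  define m where "m = Max ((\<lambda>i. norm (v $ i)) ` {..<n})"
  have "m \<in> (\<lambda>i. norm (v $ i)) ` {..<n}" using n unfolding m_def by (intro Max_in) auto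
  then obtain i where i: "i < n" "m = norm (v $ i)" by auto
  have le: "norm (v $ j) \<le> m" if "j < n" for j using that by (auto simp: m_def)
  obtain j where "j < n" "v $ j \<noteq> 0" using v by (auto simp: vec_eq_iff)
  then have m0: "m > 0" using le[of j] by (metis less_le_trans zero_less_norm_iff)
  have "(A *\<^sub>v v) $ i = e * v $ i" using eq i v by simp
  then have "norm e * m = norm (\<Sum>j<n. A $$ (i, j) * v $ j)"
    using i A v by (simp add: scalar_prod_def atLeast0LessThan norm_mult)
  also have "\<dots> \<le> (\<Sum>j<n. norm (A $$ (i, j)) * m)"
    using le by (intro sum_norm_le) (auto simp: norm_mult intro: mult_left_mono)
  also have "\<dots> \<le> b * m"
    using row[OF i(1)] m0 by (simp flip: sum_distrib_right)
  finally show ?thesis using m0 e by simp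
qed

section \<open>Matrices that are positive off the diagonal\<close>

lemma row_sums_equal:
  fixes M :: "nat \<Rightarrow> nat \<Rightarrow> real" and n :: nat
  defines "y \<equiv> \<lambda>r. \<Sum>t<n. M r t"
  assumes nonneg: "\<And>r t. r < n \<Longrightarrow> t < n \<Longrightarrow> 0 \<le> M r t"
    and pos: "\<And>r t. r < n \<Longrightarrow> t < n \<Longrightarrow> r \<noteq> t \<Longrightarrow> 0 < M r t"
    and diag: "\<And>r. r < n \<Longrightarrow> M r r = 0"
    and sym: "\<And>r t. r < n \<Longrightarrow> t < n \<Longrightarrow> M r t = M t r"
    and sq: "\<And>r. r < n \<Longrightarrow> (\<Sum>t<n. M r t * y t) = c"
    and r: "r < n" and s: "s < n"
  shows "y r = y s"
proof -
  have y_at: "y r = (\<Sum>t<n. M r t)" for r by (simp add: y_def)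
  have "Max (y ` {..<n}) \<in> y ` {..<n}" "Min (y ` {..<n}) \<in> y ` {..<n}"
    using r by (auto intro!: Max_in Min_in)
  then obtain i j where i: "i < n" "y i = Max (y ` {..<n})" and j: "j < n" "y j = Min (y ` {..<n})"
    by auto
  have le_i: "y t \<le> y i" and ge_j: "y j \<le> y t" if "t < n" for t
    using that i j by auto
  have "y i = y j"
  \<comment> \<open>Neither row \<open>i\<close> nor row \<open>j\<close> compares
    \<open>y i\<close> with \<open>y j\<close> directly: the coefficient of that difference is a
    zero diagonal entry. A third index \<open>k\<close> links the two.\<close>
  proof (cases "\<exists>k<n. k \<noteq> i \<and> k \<noteq> j")
    case True
    then obtain k where k: "k < n" "k \<noteq> i" "k \<noteq> j" by auto
    \<comment> \<open>Replacing every \<open>y t\<close> by the maximum in row \<open>j\<close>, and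
      by the minimum in row \<open>i\<close>, yields the same product \<open>y i * y j\<close>. The
      two nonnegative corrections have opposite signs in \<open>c\<close>, so both vanish.\<close>
    have dj: "c = y j * y i - (\<Sum>t<n. M j t * (y i - y t))"
      using sq[OF j(1)] by (simp add: y_at[of j] sum_distrib_right
          right_diff_distrib sum_subtractf)
    have di: "c = y i * y j + (\<Sum>t<n. M i t * (y t - y j))"
      using sq[OF i(1)] by (simp add: y_at[of i] sum_distrib_right
          right_diff_distrib sum_subtractf)
    have nj: "0 \<le> M j t * (y i - y t)" and ni: "0 \<le> M i t * (y t - y j)" if "t < n" for t
      using that nonneg i(1) j(1) le_i[of t] ge_j[of t] by auto
    have "0 \<le> (\<Sum>t<n. M j t * (y i - y t))" "0 \<le> (\<Sum>t<n. M i t * (y t - y j))"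
      using nj ni by (auto intro: sum_nonneg)
    then have "(\<Sum>t<n. M j t * (y i - y t)) = 0" "(\<Sum>t<n. M i t * (y t - y j)) = 0"
      using di dj by (auto simp: mult.commute)
    then have "M j k * (y i - y k) = 0" "M i k * (y k - y j) = 0"
      using nj ni k(1)
        sum_nonneg_eq_0_iff[of "{..<n}" "\<lambda>t. M j t * (y i - y t)"]
        sum_nonneg_eq_0_iff[of "{..<n}" "\<lambda>t. M i t * (y t - y j)"]
      by (auto simp del: mult_eq_0_iff)
    then show ?thesis using pos[OF i(1) k(1)] pos[OF j(1) k(1)] k by auto
  next
    case False
    show ?thesis
    proof (cases "i = j")
      case ne: False
      \<comment> \<open>For two indices, both row sums reduce to the single off-diagonal entry by
        symmetry.\<close>
      have "{..<n} = {i, j}" using False i j by auto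
      then show ?thesis using ne diag sym i j by (simp add: y_def)
    qed simp
  qed
  then show ?thesis using le_i[OF r] le_i[OF s] ge_j[OF r] ge_j[OF s] by simp
qed

section \<open>The distance Seidel matrix\<close>

lemma (in sym_digraph) awalk_reverse:
  assumes "awalk u p v"
  shows "\<exists>q. awalk v q u \<and> length q = length p"
  using assms
proof (induction p arbitrary: u)
  case Nil
  then show ?case by (auto simp: awalk_Nil_iff)
next
  case (Cons e p)
  then have e: "e \<in> arcs G" "u = tail G e" and w: "awalk (head G e) p v"
    by (auto simp: awalk_Cons_iff)
  obtain q where q: "awalk v q (head G e)" "length q = length p"
    using Cons.IH[OF w] by blast
  obtain e' where e': "e' \<in> arcs G" "tail G e = head G e'" "head G e = tail G e'"
    using sym_arcs e by (auto simp: symmetric_conv)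
  have "awalk (head G e) [e'] u"
    using arc_implies_awalk[OF e'(1)] e e' by simp
  then have "awalk v (q @ [e']) u" using q by (blast intro: awalk_appendI)
  then show ?case using q by (intro exI[of _ "q @ [e']"]) simp
qed

lemma (in graph) connected_reachable:
  assumes "Digraph_Component.connected G" "u \<in> verts G" "v \<in> verts G"
  shows "u \<rightarrow>\<^sup>* v"
  using assms symmetric_connected_imp_strongly_connected[OF sym_arcs]
  by (auto simp: strongly_connected_def)

lemma (in graph) graph_dist_sym:
  assumes "Digraph_Component.connected G" "u \<in> verts G" "v \<in> verts G"
  shows "graph_dist G u v = graph_dist G v u"
proof -
  have "graph_dist G v u \<le> graph_dist G u v" if uv: "u \<in> verts G" "v \<in> verts G" for u v
  proof -
    obtain p where p: "awalk u p v" "graph_dist G u v = length p"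
      using graph_dist_shortest_walk[OF connected_reachable[OF assms(1) uv]] by blast
    obtain q where q: "awalk v q u" "length q = length p"
      using awalk_reverse[OF p(1)] by blast
    obtain q' where "awalk v q' u" "graph_dist G v u = length q'" "\<And>q. awalk v q u \<Longrightarrow> length q' \<le> length q"
      using graph_dist_shortest_walk[OF connected_reachable[OF assms(1) uv(2,1)]] by blast
    then show ?thesis using p q by (metis of_nat_le_iff)
  qed
  then show ?thesis using assms by (intro antisym) auto
qed

lemma (in graph) graph_dist_self:
  assumes "u \<in> verts G"
  shows "graph_dist G u u = 0"
proof -
  obtain p where p: "awalk u p u" "graph_dist G u u = length p" "\<And>q. awalk u q u \<Longrightarrow> length p \<le> length q"
    using graph_dist_shortest_walk[OF reachable_refl[OF assms]] by blast
  have "awalk u [] u" using assms by (simp add: awalk_Nil_iff)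
  then show ?thesis using p(2) p(3)[of "[]"] by simp
qed

text \<open>A walk between distinct vertices has at least one arc. This makes
  \<open>2 * d - 1\<close> positive; connectedness excludes the default value 0 of unreachable
  pairs.\<close>

lemma (in graph) graph_dist_ge_1:
  assumes "Digraph_Component.connected G" "u \<in> verts G" "v \<in> verts G" "u \<noteq> v"
  shows "graph_dist G u v \<ge> 1"
proof -
  obtain p where p: "awalk u p v" "graph_dist G u v = length p"
    using graph_dist_shortest_walk[OF connected_reachable[OF assms(1-3)]] by blast
  moreover have "p \<noteq> []" using p assms(4) by (auto simp: awalk_Nil_iff)
  ultimately show ?thesis by (cases p) auto
qed

theorem theorem4p2:
  fixes G :: "('a, 'b) pre_digraph" and vs :: "'a list" and n :: nat
  assumes "graph G"
    and "Digraph_Component.connected G"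
    and "distinct vs" and "set vs = verts G"
    and "length vs = n" and "n \<ge> 2"
  shows "distance_seidel_spectral_radius G vs
           \<ge> sqrt ((\<Sum>r<n. (distance_seidel_degree G vs r)\<^sup>2) / real n)
         \<and>
         (distance_seidel_spectral_radius G vs
           = sqrt ((\<Sum>r<n. (distance_seidel_degree G vs r)\<^sup>2) / real n)
         \<longleftrightarrow> (\<forall>r<n. \<forall>s<n. distance_seidel_degree G vs r = distance_seidel_degree G vs s))"
proof -
  interpret graph G by fact
  have n: "n > 0" using assms by simp
  define A where "A = distance_seidel_matrix G vs"
  define \<rho> where "\<rho> = distance_seidel_spectral_radius G vs"
  define y where "y = distance_seidel_degree G vs"
  \<comment> \<open>The sign change makes the off-diagonal entries positive, and the row sums become
    the degrees.\<close>
  define M where "M r t = - A $$ (r, t)" for r t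
  define u :: "real vec" where "u = vec n (\<lambda>_. 1)"
  have \<rho>: "\<rho> = spectral_radius (map_mat complex_of_real A)"
    by (simp add: \<rho>_def A_def distance_seidel_spectral_radius_def)
  have A: "A \<in> carrier_mat n n"
    by (rule carrier_matI)
      (simp_all add: A_def distance_seidel_matrix_def distance_matrix_def assms(5))
  have A': "map_mat complex_of_real A \<in> carrier_mat n n" using A by simp
  have u: "u \<in> carrier_vec n" by (simp add: u_def)
  have vin: "vs ! r \<in> verts G" if "r < n" for r using that assms nth_mem by blast
  have vne: "vs ! r \<noteq> vs ! t" if "r < n" "t < n" "r \<noteq> t" for r t
    using that assms by (simp add: nth_eq_iff_index_eq)
  have M: "M r t = (if r = t then 0 else 2 * graph_dist G (vs ! r) (vs ! t) - 1)"
    if "r < n" "t < n" for r t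
    using that assms graph_dist_self[OF vin]
    by (simp add: M_def A_def distance_seidel_matrix_def distance_matrix_def)
  have M_sym: "M r t = M t r" if "r < n" "t < n" for r t
    using that graph_dist_sym[OF assms(2) vin vin, of r t] by (simp add: M)
  have M_pos: "0 < M r t" if "r < n" "t < n" "r \<noteq> t" for r t
    using that graph_dist_ge_1[OF assms(2) vin vin vne, of r t] by (simp add: M)
  have M_nonneg: "0 \<le> M r t" if "r < n" "t < n" for r t
    using that M_pos[of r t] by (cases "r = t") (auto simp: M)
  have sym: "A\<^sup>T = A"
    using A M_sym by (intro eq_matI) (auto simp: M_def)
  have y: "y r = (\<Sum>t<n. M r t)" if "r < n" for r
  proof -
    \<comment> \<open>The degree omits the index \<open>r\<close>, which costs nothing because the
      diagonal entry is \<open>1 - 1 - 2 * 0 = 0\<close>.\<close>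
    have "(\<Sum>t<n. M r t) = (\<Sum>t\<in>{..<n} - {r}. M r t)"
      using that by (simp add: sum.remove[of "{..<n}" r] M)
    then show ?thesis
      using that assms by (simp add: y_def distance_seidel_degree_def M)
  qed
  have Au: "(A *\<^sub>v u) $ r = - y r" if "r < n" for r
    using that A by (simp add: y M_def u_def scalar_prod_def atLeast0LessThan sum_negf)
  have uu: "u \<bullet> u = real n" by (simp add: u_def scalar_prod_def)
  have AuAu: "(A *\<^sub>v u) \<bullet> (A *\<^sub>v u) = (\<Sum>r<n. (y r)\<^sup>2)"
    using A Au by (simp add: scalar_prod_def atLeast0LessThan power2_eq_square)
  have \<rho>0: "0 \<le> \<rho>" using spectral_radius_nonneg[OF A' n] by (simp add: \<rho>)
  have "(\<Sum>r<n. (y r)\<^sup>2) / real n \<le> \<rho>\<^sup>2"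
    using symmetric_mat_norm_le[OF A sym u n] n by (simp add: AuAu uu \<rho> divide_le_eq)
  then have ineq: "sqrt ((\<Sum>r<n. (y r)\<^sup>2) / real n) \<le> \<rho>"
    using \<rho>0 by (intro real_le_lsqrt) auto
  have eq1: "y r = y s"
    if e: "\<rho> = sqrt ((\<Sum>r<n. (y r)\<^sup>2) / real n)" and rs: "r < n" "s < n" for r s
  proof -
    have "\<rho>\<^sup>2 = (\<Sum>r<n. (y r)\<^sup>2) / real n" unfolding e by (simp add: sum_nonneg)
    then have "(A *\<^sub>v u) \<bullet> (A *\<^sub>v u) = \<rho>\<^sup>2 * (u \<bullet> u)" using n by (simp add: AuAu uu)
    then have AAu: "A *\<^sub>v (A *\<^sub>v u) = \<rho>\<^sup>2 \<cdot>\<^sub>v u"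
      using symmetric_mat_norm_eq[OF A sym u n] by (simp add: \<rho>)
    have "(\<Sum>t<n. M q t * (\<Sum>k<n. M t k)) = \<rho>\<^sup>2" if q: "q < n" for q
    proof -
      \<comment> \<open>The two sign changes, in \<open>M\<close> and in \<open>y\<close>,
        cancel.\<close>
      have "(\<Sum>t<n. M q t * (\<Sum>k<n. M t k)) = (\<Sum>t<n. A $$ (q, t) * (A *\<^sub>v u) $ t)"
        using Au y by (intro sum.cong) (auto simp: M_def simp del: index_mult_mat_vec)
      also have "\<dots> = (A *\<^sub>v (A *\<^sub>v u)) $ q"
        using q A by (simp add: scalar_prod_def atLeast0LessThan)
      also have "\<dots> = \<rho>\<^sup>2" unfolding AAu using q by (simp add: u_def)
      finally show ?thesis .
    qed
    then have "(\<Sum>t<n. M r t) = (\<Sum>t<n. M s t)"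
      using rs M_nonneg M_pos M_sym by (intro row_sums_equal[of n M "\<rho>\<^sup>2"]) (auto simp: M)
    then show ?thesis using rs y by simp
  qed
  have eq2: "\<rho> = sqrt ((\<Sum>r<n. (y r)\<^sup>2) / real n)" if e: "\<forall>r<n. \<forall>s<n. y r = y s"
  proof (rule antisym[OF _ ineq])
    \<comment> \<open>For constant degrees the root mean square is \<open>\<bar>y 0\<bar>\<close>,
      so nonnegativity identifies it with the common absolute row sum that bounds
      \<open>\<rho>\<close>.\<close>
    have y0: "0 \<le> y 0" using n M_nonneg by (auto simp: y intro: sum_nonneg)
    have c: "y r = y 0" if "r < n" for r using e n that by blast
    have "\<rho> \<le> y 0" unfolding \<rho>
    proof (rule spectral_radius_le_row_sum[OF A' n])
      fix r assume r: "r < n"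
      have "(\<Sum>t<n. norm (map_mat complex_of_real A $$ (r, t))) = (\<Sum>t<n. M r t)"
        using r A M_nonneg by (intro sum.cong) (auto simp: M_def)
      then show "(\<Sum>t<n. norm (map_mat complex_of_real A $$ (r, t))) \<le> y 0"
        using y[OF r] c[OF r] by simp
    qed
    moreover have "(\<Sum>r<n. (y r)\<^sup>2) = (\<Sum>r<n. (y 0)\<^sup>2)"
      by (rule sum.cong[OF refl]) (metis c lessThan_iff)
    then have "y 0 = sqrt ((\<Sum>r<n. (y r)\<^sup>2) / real n)"
      using n y0 by simp
    ultimately show "\<rho> \<le> sqrt ((\<Sum>r<n. (y r)\<^sup>2) / real n)" by simp
  qed
  show ?thesis
    using ineq eq1 eq2 unfolding \<rho>_def y_def by blast
qed

end
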